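(* Let $N=(P,T,F,m)$ be a finite marked occurrence net and $[\![N]\!]\in\mathcal{D}(P\cup\overline{\mathbf{P}})$ its encoding. If $[\![N]\!]\to^*(T_1,b)$ and two transitions $t,t'$ are both enabled at $(T_1,b)$ (i.e. $t,t'\in T_1$ and ${}^\bullet t\subseteq b$, ${}^\bullet t'\subseteq b$), then either ${}^\bullet t={}^\bullet t'$ or ${}^\bullet t\cap{}^\bullet t'=\emptyset$.
   Context: Nets: a net is $(P,T,F)$ with $F\subseteq(P\times T)\cup(T\times P)$, ${}^\bullet x=\{y\mid(y,x)\in F\}$, $x^\bullet=\{z\mid(x,z)\in F\}$; transitions have nonempty pre- and postsets. $\preceq=F^*$. $t_1\#_0t_2$ if $t_1\neq t_2$ and ${}^\bullet t_1\cap{}^\bullet t_2\neq\emptyset$; $x\#y$ if there are $t_1\#_0t_2$ with $(t_1,x),(t_2,y)\in F^+$. An occurrence net has acyclic $F$, $|{}^\bullet p|\le1$ for all places, and no $t\#t$. A deterministic process from marking $m_0$ is given by a set $\theta$ of transitions, closed under $\preceq$-predecessor transitions, pairwise not in immediate conflict, all fireable in some order from $m_0$; maximal if no further transition is enabled afterwards; $\max\theta$ denotes its final places. S-cells: $\mathsf{Pre}=F\cap(P\times T)$, $\sqsubseteq=(\preceq\cup\mathsf{Pre}^{-1})^*$, $x\leftrightarrow y$ iff $x\sqsubseteq y\sqsubseteq x$; $BC(N)=\{[t]_\leftrightarrow\mid t\in T\}$. $N_{\mathbb{C}}$ is the subnet with elements $\mathbb{C}\cup\bigcup_{t\in\mathbb{C}\cap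 T}t^\bullet$; $\min\mathbb{C}$, $\max\mathbb{C}$ its places with empty preset, resp. postset, in $N_{\mathbb{C}}$. A transaction $\theta:\mathbb{C}$ is a maximal deterministic process of $N_{\mathbb{C}}$ from $\min\mathbb{C}$. Removal: for $p\in\min M$ ($\min M$ = places with empty preset), $M\ominus p$ is the least subnet containing $\min M\setminus\{p\}$, every transition of $M$ whose preset it contains, and the postsets of its transitions. Dynamic p-nets over $\mathbb{S}=P\uplus\mathbf{P}$ (regular/persistent places): $\mathcal{D}(\mathbb{S})$ is the least set with $(T_0,b)\in\mathcal{D}(\mathbb{S})$ when $T_0$ is a finite set of pairs $S\to N_0$ ($S\subseteq\mathbb{S}$, $N_0\in\mathcal{D}(\mathbb{S})$) and $b:\mathbb{S}\to\mathbb{N}\cup\{\infty\}$ with $b(\mathbf{p})\in\{0,\infty\}$ on persistent places. ${}^\bullet(S\to N_0)=S$. Firing: if $t=S\to(T',b')\in T_0$, $S\subseteq b$, then $(T_0,b)\xrightarrow{t}(T_0\cup T',(b\setminus S)\cup b')$ (pointwise sum/difference, $\infty$ absorbing). Encoding: $\overline{\mathbf{P}}=\{\overline{\mathbf{p}}\mid p\in P\}$ fresh persistent places, $\overline{X}=\{\overline{\mathbf{x}}\mid x\in X\}$. $[\![N]\!]=(T_{pos}\cup T_{neg},m)$ with $T_{pos}=\{\min\mathbb{C}\to(\emptyset,\max\theta\cup\overline{\max\mathbb{C}\setminus\max\theta})\mid\mathbb{C}\in BC(N),\theta:\mathbb{C}\}$, $T_{neg}=\{\overline{\mathbf{p}}\to(T',\overline{\max\mathbb{C}\setminus\max(N_{\mathbb{C}}\ominus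 p)})\mid\mathbb{C}\in BC(N),p\in\min\mathbb{C},(T',b_0)=[\![N_{\mathbb{C}}\ominus p]\!]\}$, the recursive encodings being of the unmarked subnets; in postset bags regular places count $1$, places of $\overline{\mathbf{P}}$ count $\infty$.
   Formalization: The initial marking m is taken to be a set of places with empty preset (m ⊆ min N, one token each, covering the usual m = min N); for arbitrary markings m the claim fails. *)

theory Defs
  imports Complex_Main "HOL-Library.FSet" "HOL-Library.Extended_Nat"
begin

text \<open>Places and transitions are drawn from one type, so that S-cells and subnets are plain sets of
  elements; disjointness is part of \<open>wf_net\<close>.\<close>

record 'a net =
  places :: "'a set"
  transitions :: "'a set"
  flow :: "('a \<times> 'a) set"

definition pre :: "'a net \<Rightarrow> 'a \<Rightarrow> 'a set" where
  "pre N x = {y. (y, x) \<in> flow N}"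

definition post :: "'a net \<Rightarrow> 'a \<Rightarrow> 'a set" where
  "post N x = {z. (x, z) \<in> flow N}"

definition wf_net :: "'a net \<Rightarrow> bool" where
  "wf_net N \<longleftrightarrow>
     places N \<inter> transitions N = {} \<and>
     flow N \<subseteq> (places N \<times> transitions N) \<union> (transitions N \<times> places N) \<and>
     (\<forall>t \<in> transitions N. pre N t \<noteq> {} \<and> post N t \<noteq> {})"

definition finite_net :: "'a net \<Rightarrow> bool" where
  "finite_net N \<longleftrightarrow> finite (places N) \<and> finite (transitions N)"

definition causal :: "'a net \<Rightarrow> ('a \<times> 'a) set" where
  "causal N = (flow N)\<^sup>*"

definition immediate_conflict :: "'a net \<Rightarrow> 'a \<Rightarrow> 'a \<Rightarrow> bool" where
  "immediate_conflict N t1 t2 \<longleftrightarrow>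
     t1 \<in> transitions N \<and> t2 \<in> transitions N \<and> t1 \<noteq> t2 \<and> pre N t1 \<inter> pre N t2 \<noteq> {}"

definition conflict :: "'a net \<Rightarrow> 'a \<Rightarrow> 'a \<Rightarrow> bool" where
  "conflict N x y \<longleftrightarrow>
     (\<exists>t1 t2. immediate_conflict N t1 t2 \<and> (t1, x) \<in> (flow N)\<^sup>+ \<and> (t2, y) \<in> (flow N)\<^sup>+)"

definition occurrence_net :: "'a net \<Rightarrow> bool" where
  "occurrence_net N \<longleftrightarrow>
     wf_net N \<and>
     acyclic (flow N) \<and>
     (\<forall>p \<in> places N. finite (pre N p) \<and> card (pre N p) \<le> 1) \<and>
     (\<forall>t \<in> transitions N. \<not> conflict N t t)"

definition min_places :: "'a net \<Rightarrow> 'a set" where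
  "min_places N = {p \<in> places N. pre N p = {}}"

definition max_places :: "'a net \<Rightarrow> 'a set" where
  "max_places N = {p \<in> places N. post N p = {}}"

definition subnet :: "'a net \<Rightarrow> 'a set \<Rightarrow> 'a net" where
  "subnet N X =
     \<lparr>places = places N \<inter> X, transitions = transitions N \<inter> X, flow = flow N \<inter> (X \<times> X)\<rparr>"

text \<open>Markings of nets are sets of places: every place of an occurrence net receives at most one
  token in a run that starts with single tokens on minimal places.\<close>

inductive fires :: "'a net \<Rightarrow> 'a set \<Rightarrow> 'a list \<Rightarrow> 'a set \<Rightarrow> bool" for N where
  fires_Nil: "fires N m [] m"
| fires_Cons: "\<lbrakk>t \<in> transitions N; pre N t \<subseteq> m; fires N ((m - pre N t) \<union> post N t) ts m'\<rbrakk>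
    \<Longrightarrow> fires N m (t # ts) m'"

definition det_process :: "'a net \<Rightarrow> 'a set \<Rightarrow> 'a set \<Rightarrow> bool" where
  "det_process N m0 \<theta> \<longleftrightarrow>
     \<theta> \<subseteq> transitions N \<and>
     (\<forall>t \<in> \<theta>. \<forall>u \<in> transitions N. (u, t) \<in> causal N \<longrightarrow> u \<in> \<theta>) \<and>
     (\<forall>t \<in> \<theta>. \<forall>u \<in> \<theta>. \<not> immediate_conflict N t u) \<and>
     (\<exists>ts m'. distinct ts \<and> set ts = \<theta> \<and> fires N m0 ts m')"

text \<open>The final places include the initially marked places that \<open>\<theta>\<close> does not consume.\<close>

definition final_places :: "'a net \<Rightarrow> 'a set \<Rightarrow> 'a set \<Rightarrow> 'a set" where
  "final_places N m0 \<theta> = (m0 \<union> (\<Union>t\<in>\<theta>. post N t)) - (\<Union>t\<in>\<theta>. pre N t)"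

definition max_det_process :: "'a net \<Rightarrow> 'a set \<Rightarrow> 'a set \<Rightarrow> bool" where
  "max_det_process N m0 \<theta> \<longleftrightarrow>
     det_process N m0 \<theta> \<and> (\<forall>t \<in> transitions N. \<not> pre N t \<subseteq> final_places N m0 \<theta>)"

definition cell_le :: "'a net \<Rightarrow> ('a \<times> 'a) set" where
  "cell_le N = (causal N \<union> (flow N \<inter> (places N \<times> transitions N))\<inverse>)\<^sup>*"

definition cell_of :: "'a net \<Rightarrow> 'a \<Rightarrow> 'a set" where
  "cell_of N x = {y. (x, y) \<in> cell_le N \<and> (y, x) \<in> cell_le N}"

definition BC :: "'a net \<Rightarrow> 'a set set" where
  "BC N = cell_of N ` transitions N"

definition cell_net :: "'a net \<Rightarrow> 'a set \<Rightarrow> 'a net" where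
  "cell_net N C = subnet N (C \<union> (\<Union>t \<in> C \<inter> transitions N. post N t))"

definition cell_min :: "'a net \<Rightarrow> 'a set \<Rightarrow> 'a set" where
  "cell_min N C = min_places (cell_net N C)"

definition cell_max :: "'a net \<Rightarrow> 'a set \<Rightarrow> 'a set" where
  "cell_max N C = max_places (cell_net N C)"

definition transaction :: "'a net \<Rightarrow> 'a set \<Rightarrow> 'a set \<Rightarrow> bool" where
  "transaction N \<theta> C \<longleftrightarrow> max_det_process (cell_net N C) (cell_min N C) \<theta>"

definition transaction_max :: "'a net \<Rightarrow> 'a set \<Rightarrow> 'a set \<Rightarrow> 'a set" where
  "transaction_max N \<theta> C = final_places (cell_net N C) (cell_min N C) \<theta>"

inductive_set removal_elems :: "'a net \<Rightarrow> 'a \<Rightarrow> 'a set" for M :: "'a net" and p :: 'a where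
  removal_min: "\<lbrakk>q \<in> min_places M; q \<noteq> p\<rbrakk> \<Longrightarrow> q \<in> removal_elems M p"
| removal_trans: "\<lbrakk>t \<in> transitions M; \<forall>q \<in> pre M t. q \<in> removal_elems M p\<rbrakk>
    \<Longrightarrow> t \<in> removal_elems M p"
| removal_post: "\<lbrakk>t \<in> transitions M; t \<in> removal_elems M p; q \<in> post M t\<rbrakk>
    \<Longrightarrow> q \<in> removal_elems M p"

definition removal :: "'a net \<Rightarrow> 'a \<Rightarrow> 'a net" (infixl "\<ominus>" 65) where
  "M \<ominus> p = subnet M (removal_elems M p)"

text \<open>A pair \<open>(S, N0)\<close> stands for the transition \<open>S \<rightarrow> N0\<close>. The datatype provides the least-fixpoint
  reading and the finiteness of the transition sets; \<open>dyn_nets R Q\<close> adds the constraints imposed by the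
  regular places \<open>R\<close> and the persistent places \<open>Q\<close>, with bags over \<open>R \<union> Q\<close> extended by \<open>0\<close>.\<close>

datatype 's dnet = DNet (dtrans: "('s set \<times> 's dnet) fset") (dmark: "'s \<Rightarrow> enat")

type_synonym 's dtransition = "'s set \<times> 's dnet"

inductive_set dyn_nets :: "'s set \<Rightarrow> 's set \<Rightarrow> 's dnet set" for R Q :: "'s set" where
  dyn_netI: "\<lbrakk>\<And>S N0. (S, N0) \<in> fset T0 \<Longrightarrow> S \<subseteq> R \<union> Q;
     \<And>S N0. (S, N0) \<in> fset T0 \<Longrightarrow> N0 \<in> dyn_nets R Q;
     \<And>s. s \<notin> R \<union> Q \<Longrightarrow> b s = 0;
     \<And>s. s \<in> Q \<Longrightarrow> b s \<in> {0, \<infinity>}\<rbrakk>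
    \<Longrightarrow> DNet T0 b \<in> dyn_nets R Q"

definition dpre :: "'s dtransition \<Rightarrow> 's set" where
  "dpre t = fst t"

definition set_le_bag :: "'s set \<Rightarrow> ('s \<Rightarrow> enat) \<Rightarrow> bool" where
  "set_le_bag S b \<longleftrightarrow> (\<forall>s \<in> S. 1 \<le> b s)"

definition denabled :: "'s dnet \<Rightarrow> 's dtransition \<Rightarrow> bool" where
  "denabled D t \<longleftrightarrow> t \<in> fset (dtrans D) \<and> set_le_bag (dpre t) (dmark D)"

definition dfire :: "'s dnet \<Rightarrow> 's dtransition \<Rightarrow> 's dnet" where
  "dfire D t = DNet (dtrans D |\<union>| dtrans (snd t))
     (\<lambda>s. (dmark D s - (if s \<in> dpre t then 1 else 0)) + dmark (snd t) s)"

definition dstep :: "'s dnet \<Rightarrow> 's dnet \<Rightarrow> bool" where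
  "dstep D D' \<longleftrightarrow> (\<exists>t. denabled D t \<and> D' = dfire D t)"

text \<open>\<open>Reg p\<close> is the regular place \<open>p\<close>, and \<open>Bar p\<close> is the fresh persistent place for \<open>p\<close>.\<close>

datatype 'a dplace = Reg 'a | Bar 'a

definition enc_bag :: "'a set \<Rightarrow> 'a set \<Rightarrow> 'a dplace \<Rightarrow> enat" where
  "enc_bag X Y s = (case s of Reg p \<Rightarrow> if p \<in> X then 1 else 0 | Bar p \<Rightarrow> if p \<in> Y then \<infinity> else 0)"

definition T_pos :: "'a net \<Rightarrow> 'a dplace dtransition set" where
  "T_pos N = {(Reg ` cell_min N C,
               DNet {||} (enc_bag (transaction_max N \<theta> C) (cell_max N C - transaction_max N \<theta> C)))
              | C \<theta>. C \<in> BC N \<and> transaction N \<theta> C}"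

lemma finite_T_pos:
  assumes "finite_net N"
  shows "finite (T_pos N)"
proof -
  let ?f = "\<lambda>(C, \<theta>). (Reg ` cell_min N C,
     DNet {||} (enc_bag (transaction_max N \<theta> C) (cell_max N C - transaction_max N \<theta> C)))"
  have "T_pos N \<subseteq> ?f ` (BC N \<times> Pow (transitions N))"
    by (fastforce simp: T_pos_def transaction_def max_det_process_def det_process_def
        cell_net_def subnet_def)
  moreover have "finite (BC N \<times> Pow (transitions N))"
    using assms by (auto simp: BC_def finite_net_def)
  ultimately show ?thesis
    by (meson finite_imageI finite_subset)
qed

lemma finite_subnet: "finite_net N \<Longrightarrow> finite_net (subnet N X)"
  by (simp add: finite_net_def subnet_def)

definition flow_ok :: "'a net \<Rightarrow> bool" where
  "flow_ok N \<longleftrightarrow> places N \<inter> transitions N = {} \<and>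
     flow N \<subseteq> (places N \<times> transitions N) \<union> (transitions N \<times> places N)"

lemma flow_ok_subnet: "flow_ok N \<Longrightarrow> flow_ok (subnet N X)"
  unfolding flow_ok_def subnet_def by auto

lemma cell_min_subset: "cell_min N C \<subseteq> places N"
  by (auto simp: cell_min_def min_places_def cell_net_def subnet_def)

lemma places_removal_cell_net: "places (cell_net N C \<ominus> p) \<subseteq> places N"
  by (auto simp: removal_def cell_net_def subnet_def)

lemma not_in_removal:
  assumes "p \<in> min_places M" "p \<notin> transitions M"
  shows "p \<notin> removal_elems M p"
proof
  assume "p \<in> removal_elems M p"
  then show False
    by (cases rule: removal_elems.cases) (use assms in \<open>auto simp: min_places_def pre_def post_def\<close>)
qed

text \<open>The recursive calls sit in an image so that the termination proof sees \<open>p \<in> cell_min N C\<close>; the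
  equation \<open>encode N m = (T_pos N \<union> T_neg N, m)\<close> is \<open>encode_eq\<close> below, and \<open>encode_dyn_net\<close> shows that the
  result is a dynamic p-net over \<open>P\<close> and its barred copy.
  For the nets of interest the conditional below is vacuous; it makes the recursion total. The
  conjunct \<open>places N \<inter> transitions N = {}\<close> ensures that \<open>p\<close> is indeed absent from the net on which the
  recursive call is made.\<close>

function encode :: "'a net \<Rightarrow> 'a set \<Rightarrow> 'a dplace dnet" where
  "encode N m =
     (if finite_net N \<and> places N \<inter> transitions N = {} then
        DNet (Abs_fset (T_pos N \<union>
          (\<lambda>(C, p). ({Bar p},
             DNet (dtrans (encode (cell_net N C \<ominus> p) {}))
               (enc_bag {} (cell_max N C - max_places (cell_net N C \<ominus> p)))))
          ` (SIGMA C : BC N. cell_min N C)))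
        (enc_bag m {})
      else DNet {||} (enc_bag m {}))"
  by pat_completeness auto
termination
proof (relation "measure (\<lambda>(N, m). card (places N))", goal_cases)
  case 1
  show ?case by simp
next
  case (2 N m x C p)
  have p: "p \<in> cell_min N C" and fin: "finite (places N)"
    and disj: "places N \<inter> transitions N = {}"
    using 2 by (auto simp: finite_net_def)
  have "p \<in> places N" using p cell_min_subset[of N C] by blast
  moreover have "p \<notin> removal_elems (cell_net N C) p"
  proof (rule not_in_removal)
    show "p \<in> min_places (cell_net N C)" using p by (simp add: cell_min_def)
    show "p \<notin> transitions (cell_net N C)"
      using \<open>p \<in> places N\<close> disj by (auto simp: cell_net_def subnet_def)
  qed
  ultimately have "places (cell_net N C \<ominus> p) \<subset> places N"
    using places_removal_cell_net[of N C p] by (auto simp: removal_def subnet_def)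
  then show ?case using fin by (auto intro: psubset_card_mono)
qed

declare encode.simps [simp del]

definition T_neg :: "'a net \<Rightarrow> 'a dplace dtransition set" where
  "T_neg N = {({Bar p}, DNet T' (enc_bag {} (cell_max N C - max_places (cell_net N C \<ominus> p))))
              | C p T' b0. C \<in> BC N \<and> p \<in> cell_min N C \<and> encode (cell_net N C \<ominus> p) {} = DNet T' b0}"

lemma T_neg_image:
  "T_neg N = (\<lambda>(C, p). ({Bar p},
             DNet (dtrans (encode (cell_net N C \<ominus> p) {}))
               (enc_bag {} (cell_max N C - max_places (cell_net N C \<ominus> p)))))
          ` (SIGMA C : BC N. cell_min N C)" (is "_ = ?R")
proof
  show "T_neg N \<subseteq> ?R" by (force simp: T_neg_def)
  show "?R \<subseteq> T_neg N"
    unfolding T_neg_def by clarsimp (metis dnet.exhaust_sel)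
qed

lemma finite_T_neg:
  assumes "finite_net N"
  shows "finite (T_neg N)"
proof -
  have "finite (SIGMA C : BC N. cell_min N C)"
    using assms finite_subset[OF cell_min_subset[of N]]
    by (intro finite_SigmaI) (auto simp: BC_def finite_net_def)
  then show ?thesis by (simp add: T_neg_image)
qed

theorem encode_eq:
  assumes "finite_net N" "places N \<inter> transitions N = {}"
  shows "fset (dtrans (encode N m)) = T_pos N \<union> T_neg N" "dmark (encode N m) = enc_bag m {}"
proof -
  have "encode N m = DNet (Abs_fset (T_pos N \<union> T_neg N)) (enc_bag m {})"
    by (subst encode.simps) (simp add: assms T_neg_image)
  then show "fset (dtrans (encode N m)) = T_pos N \<union> T_neg N" "dmark (encode N m) = enc_bag m {}"
    using assms by (simp_all add: Abs_fset_inverse finite_T_pos finite_T_neg)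
qed

lemma dyn_nets_dtrans:
  assumes "D \<in> dyn_nets R Q" "(S, N0) \<in> fset (dtrans D)"
  shows "S \<subseteq> R \<union> Q" "N0 \<in> dyn_nets R Q"
proof -
  have "S \<subseteq> R \<union> Q \<and> N0 \<in> dyn_nets R Q"
    using assms(1)
  proof cases
    case (dyn_netI T0 b)
    have "(S, N0) \<in> fset T0" using assms(2) dyn_netI(1) by simp
    then show ?thesis using dyn_netI(2,3) by blast
  qed
  then show "S \<subseteq> R \<union> Q" "N0 \<in> dyn_nets R Q" by auto
qed

lemma enc_bag_dyn_net:
  assumes "X \<subseteq> P" "Y \<subseteq> P"
    and "\<And>S N0. (S, N0) \<in> fset T0 \<Longrightarrow> S \<subseteq> Reg ` P \<union> Bar ` P \<and> N0 \<in> dyn_nets (Reg ` P) (Bar ` P)"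
  shows "DNet T0 (enc_bag X Y) \<in> dyn_nets (Reg ` P) (Bar ` P)"
proof (rule dyn_netI)
  show "S \<subseteq> Reg ` P \<union> Bar ` P" "N0 \<in> dyn_nets (Reg ` P) (Bar ` P)" if "(S, N0) \<in> fset T0" for S N0
    using assms(3)[OF that] by auto
  show "enc_bag X Y s = 0" if "s \<notin> Reg ` P \<union> Bar ` P" for s
    using that assms(1,2) by (auto simp: enc_bag_def split: dplace.split)
  show "enc_bag X Y s \<in> {0, \<infinity>}" if "s \<in> Bar ` P" for s
    using that by (cases s) (simp_all add: enc_bag_def image_iff)
qed

lemma cell_max_subset: "cell_max N C \<subseteq> places N"
  by (auto simp: cell_max_def max_places_def cell_net_def subnet_def)

lemma transaction_max_subset:
  assumes flow: "flow N \<subseteq> (places N \<times> transitions N) \<union> (transitions N \<times> places N)"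
    and disj: "places N \<inter> transitions N = {}" and "transaction N \<theta> C"
  shows "transaction_max N \<theta> C \<subseteq> places N"
proof -
  have "\<theta> \<subseteq> transitions N"
    using assms(3) by (auto simp: transaction_def max_det_process_def det_process_def
        cell_net_def subnet_def)
  then have "post (cell_net N C) t \<subseteq> places N" if "t \<in> \<theta>" for t
    using that flow disj by (auto simp: post_def cell_net_def subnet_def)
  then show ?thesis
    using cell_min_subset[of N C] by (auto simp: transaction_max_def final_places_def)
qed

theorem encode_in_dyn_nets:
  assumes "finite_net N" "flow_ok N" "places N \<subseteq> P" and "m \<subseteq> P"
  shows "encode N m \<in> dyn_nets (Reg ` P) (Bar ` P)"
  using assms
proof (induction N m rule: encode.induct)
  case (1 N m)
  note fin = 1(2) and ok = 1(3) and P = 1(4) and m = 1(5)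
  have disj: "places N \<inter> transitions N = {}"
    and flow: "flow N \<subseteq> (places N \<times> transitions N) \<union> (transitions N \<times> places N)"
    using ok by (auto simp only: flow_ok_def)
  have IH: "encode (cell_net N C \<ominus> p) {} \<in> dyn_nets (Reg ` P) (Bar ` P)"
    if "C \<in> BC N" "p \<in> cell_min N C" for C p
  proof (rule 1(1)[of "(C, p)" C p])
    show "finite_net (cell_net N C \<ominus> p)"
      using fin by (simp add: removal_def cell_net_def finite_subnet)
    show "places (cell_net N C \<ominus> p) \<subseteq> P"
      by (rule order_trans[OF places_removal_cell_net P])
    show "flow_ok (cell_net N C \<ominus> p)"
      using ok by (simp add: removal_def cell_net_def flow_ok_subnet)
    show "(C, p) \<in> (SIGMA C : BC N. cell_min N C)" using that by simp
    show "finite_net N \<and> places N \<inter> transitions N = {}" using fin disj by simp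
  qed simp_all
  have tr: "S \<subseteq> Reg ` P \<union> Bar ` P \<and> N0 \<in> dyn_nets (Reg ` P) (Bar ` P)"
    if "(S, N0) \<in> fset (dtrans (encode N m))" for S N0
  proof -
    from that consider "(S, N0) \<in> T_pos N" | "(S, N0) \<in> T_neg N"
      using encode_eq(1)[OF fin disj] by blast
    then show ?thesis
    proof cases
      case 1
      then obtain C \<theta> where C: "transaction N \<theta> C" "S = Reg ` cell_min N C"
        and N0: "N0 = DNet {||}
          (enc_bag (transaction_max N \<theta> C) (cell_max N C - transaction_max N \<theta> C))"
        by (auto simp: T_pos_def)
      have "N0 \<in> dyn_nets (Reg ` P) (Bar ` P)"
        unfolding N0
      proof (rule enc_bag_dyn_net)
        show "transaction_max N \<theta> C \<subseteq> P"
          using transaction_max_subset[OF flow disj C(1)] P by blast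
        show "cell_max N C - transaction_max N \<theta> C \<subseteq> P"
          using cell_max_subset[of N C] P by blast
      qed simp
      moreover have "S \<subseteq> Reg ` P \<union> Bar ` P"
        using C(2) cell_min_subset[of N C] P by blast
      ultimately show ?thesis by blast
    next
      case 2
      then obtain C p T' b0 where Cp: "C \<in> BC N" "p \<in> cell_min N C" "S = {Bar p}"
        and enc: "encode (cell_net N C \<ominus> p) {} = DNet T' b0"
        and N0: "N0 = DNet T' (enc_bag {} (cell_max N C - max_places (cell_net N C \<ominus> p)))"
        by (auto simp: T_neg_def)
      have "N0 \<in> dyn_nets (Reg ` P) (Bar ` P)"
        unfolding N0
      proof (rule enc_bag_dyn_net)
        show "cell_max N C - max_places (cell_net N C \<ominus> p) \<subseteq> P"
          using cell_max_subset[of N C] P by blast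
        show "S' \<subseteq> Reg ` P \<union> Bar ` P \<and> N' \<in> dyn_nets (Reg ` P) (Bar ` P)"
          if "(S', N') \<in> fset T'" for S' N'
          using dyn_nets_dtrans[OF IH[OF Cp(1,2)], of S' N'] that enc by simp
      qed simp
      moreover have "S \<subseteq> Reg ` P \<union> Bar ` P"
        using Cp cell_min_subset[of N C] P by blast
      ultimately show ?thesis by blast
    qed
  qed
  have "encode N m = DNet (dtrans (encode N m)) (enc_bag m {})"
    using encode_eq(2)[OF fin disj, of m] by (cases "encode N m") simp
  moreover have "DNet (dtrans (encode N m)) (enc_bag m {}) \<in> dyn_nets (Reg ` P) (Bar ` P)"
    using m tr by (intro enc_bag_dyn_net) auto
  ultimately show ?case by simp
qed

corollary encode_dyn_net:
  assumes "finite_net N" "occurrence_net N" "m \<subseteq> places N"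
  shows "encode N m \<in> dyn_nets (Reg ` places N) (Bar ` places N)"
  using assms by (intro encode_in_dyn_nets) (simp_all add: occurrence_net_def wf_net_def flow_ok_def)

end

theory Submission
  imports Defs
begin

text \<open>Negative transitions have singleton presets \<open>{Bar p}\<close>, so only two positive transitions, with
  presets \<open>min C1\<close> and \<open>min C2\<close> for cells of possibly different recursive encodings, can be a problem.
  Every cell occurring in the recursion is a strongly connected component of the graph
  \<open>F \<union> Pre\<inverse>\<close> after deletion of everything causally above some set of places whose barred copies are
  marked. Let \<open>B\<close> be the set of all places whose barred copies are currently marked. If a cell is enabled, then
  no element of it lies above \<open>B\<close>, so it is a component of the graph with everything above the whole
  of \<open>B\<close> deleted. Two enabled cells are thus components of one and the same graph and either coincide
  or are disjoint.

  That an enabled cell avoids everything above \<open>B\<close> rests on two invariants. No marked regular place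
  lies above \<open>B\<close>. And a barred place was always put there as an exit of an earlier cell, which, by
  maximality, contains every coherent set that meets it and avoids the older barred places; so a new
  barred place cannot lie in the interior of such a set.\<close>

section \<open>Firing sequences and strong components\<close>

lemma fires_pre:
  assumes "fires M m0 ts m'" "t \<in> set ts"
  shows "pre M t \<subseteq> m0 \<union> (\<Union>u\<in>set ts. post M u)"
  using assms
proof (induction arbitrary: t rule: fires.induct)
  case (fires_Cons u m0 ts m')
  then show ?case by (cases "t = u") fastforce+
qed simp

text \<open>Reduces the order to reachability along single edges, so that cells become strongly
  connected components of a graph.\<close>

lemma cell_le_alt:
  "cell_le M = (flow M \<union> (flow M \<inter> (places M \<times> transitions M))\<inverse>)\<^sup>*"
proof -
  have "cell_le M = ((flow M)\<^sup>* \<union> ((flow M \<inter> (places M \<times> transitions M))\<inverse>))\<^sup>*"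
    by (simp add: cell_le_def causal_def)
  also have "\<dots> = (flow M \<union> (flow M \<inter> (places M \<times> transitions M))\<inverse>)\<^sup>*"
  proof (rule rtrancl_subset)
    show "flow M \<union> (flow M \<inter> (places M \<times> transitions M))\<inverse>
        \<subseteq> (flow M)\<^sup>* \<union> (flow M \<inter> (places M \<times> transitions M))\<inverse>"
      by blast
    show "(flow M)\<^sup>* \<union> (flow M \<inter> (places M \<times> transitions M))\<inverse>
        \<subseteq> (flow M \<union> (flow M \<inter> (places M \<times> transitions M))\<inverse>)\<^sup>*"
      by (auto intro: rtrancl_mono[THEN subsetD, rotated])
  qed
  finally show ?thesis .
qed

text \<open>Every vertex on a path between mutually reachable vertices belongs to their component,
  so the path never leaves \<open>C\<close>.\<close>

lemma rtrancl_within_component: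
  assumes "(x, y) \<in> R\<^sup>*" "(y, x) \<in> R\<^sup>*" and C: "C = {z. (x, z) \<in> R\<^sup>* \<and> (z, x) \<in> R\<^sup>*}"
  shows "(x, y) \<in> (R \<inter> C \<times> C)\<^sup>*"
  using assms(1,2)
proof (induction rule: rtrancl_induct)
  case (step y z)
  have "(y, x) \<in> R\<^sup>*" using step by (meson converse_rtrancl_into_rtrancl)
  moreover have "(y, z) \<in> R \<inter> C \<times> C"
    using step \<open>(y, x) \<in> R\<^sup>*\<close> by (auto simp: C)
  ultimately show ?case using step.IH by (meson rtrancl.rtrancl_into_rtrancl)
qed simp

locale finite_occurrence_net =
  fixes N :: "'a net"
  assumes fin: "finite_net N" and occ: "occurrence_net N"
begin

abbreviation "F \<equiv> flow N"
abbreviation "T \<equiv> transitions N"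
abbreviation "P \<equiv> places N"

lemma disj: "P \<inter> T = {}" and flow: "F \<subseteq> P \<times> T \<union> T \<times> P"
  using occ by (auto simp: occurrence_net_def wf_net_def)

lemma flow_types:
  assumes "(x, y) \<in> F"
  shows "x \<in> T \<longleftrightarrow> y \<in> P" "x \<in> P \<longleftrightarrow> y \<in> T"
  using assms flow disj by auto

lemma wf_flow: "wf F"
proof (rule finite_acyclic_wf)
  show "finite F"
    using fin flow by (auto simp: finite_net_def intro: finite_subset)
qed (use occ in \<open>simp add: occurrence_net_def\<close>)

lemma producer_unique: "(t, p) \<in> F \<Longrightarrow> (u, p) \<in> F \<Longrightarrow> p \<in> P \<Longrightarrow> t = u"
proof -
  assume "(t, p) \<in> F" "(u, p) \<in> F" "p \<in> P"
  moreover from this have "finite (pre N p)" "card (pre N p) \<le> Suc 0"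
    using occ by (auto simp: occurrence_net_def)
  ultimately show "t = u"
    by (auto simp: card_le_Suc0_iff_eq pre_def)
qed

subsection \<open>Cells as strong components\<close>

definition up :: "'a set \<Rightarrow> 'a set" where
  "up B = F\<^sup>* `` B"

lemma up_step: "x \<in> up B \<Longrightarrow> (x, y) \<in> F \<Longrightarrow> y \<in> up B"
  by (auto simp: up_def intro: rtrancl_into_rtrancl)

lemma up_steps: "x \<in> up B \<Longrightarrow> (x, y) \<in> F\<^sup>* \<Longrightarrow> y \<in> up B"
  by (auto simp: up_def intro: rtrancl_trans)

lemma up_Un: "up (B \<union> C) = up B \<union> up C"
  by (auto simp: up_def)

lemma up_mono: "B \<subseteq> C \<Longrightarrow> up B \<subseteq> up C"
  by (auto simp: up_def)

lemma subset_up: "B \<subseteq> up B"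
  by (auto simp: up_def)

definition edges :: "('a \<times> 'a) set" where
  "edges = F \<union> (F \<inter> P \<times> T)\<inverse>"

text \<open>Captures strong components without maximality. Preset closure is a separate clause
  because a lone transition is already strongly connected.\<close>

definition coherent :: "'a set \<Rightarrow> bool" where
  "coherent C \<longleftrightarrow> (\<forall>t \<in> C \<inter> T. pre N t \<subseteq> C) \<and> (\<forall>x \<in> C. \<forall>y \<in> C. (x, y) \<in> (edges \<inter> C \<times> C)\<^sup>*)"

text \<open>Maximality is stated inside \<open>N\<close>, with the removed places \<open>B\<close>
  as sole parameter, so that cells of different recursive nets can be compared.\<close>

definition cell :: "'a set \<Rightarrow> 'a set \<Rightarrow> bool" where
  "cell B D \<longleftrightarrow> coherent D \<and> D \<inter> T \<noteq> {} \<and> D \<inter> up B = {} \<and>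
     (\<forall>C t. coherent C \<and> C \<inter> up B = {} \<and> t \<in> C \<inter> D \<inter> T \<longrightarrow> C \<subseteq> D)"

text \<open>\<open>cell_min_entry\<close> and \<open>cell_max_exits\<close> relate this set and
  \<open>exits\<close> to the minimal and maximal places of a cell net.\<close>

definition entry :: "'a set \<Rightarrow> 'a set" where
  "entry C = {p \<in> C \<inter> P. pre N p \<inter> C = {}}"

definition exits :: "'a set \<Rightarrow> 'a set" where
  "exits C = (\<Union>t \<in> C \<inter> T. post N t) - C"

lemma coherent_Un:
  assumes "coherent C" "coherent D" "p \<in> C \<inter> D"
  shows "coherent (C \<union> D)"
proof -
  let ?U = "edges \<inter> (C \<union> D) \<times> (C \<union> D)"
  have sub: "(edges \<inter> C \<times> C)\<^sup>* \<subseteq> ?U\<^sup>*" "(edges \<inter> D \<times> D)\<^sup>* \<subseteq> ?U\<^sup>*"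
    by (auto intro!: rtrancl_mono)
  have "(x, p) \<in> ?U\<^sup>*" "(p, x) \<in> ?U\<^sup>*" if "x \<in> C \<union> D" for x
    using that assms sub unfolding coherent_def by blast+
  then have "\<forall>x \<in> C \<union> D. \<forall>y \<in> C \<union> D. (x, y) \<in> ?U\<^sup>*"
    by (meson rtrancl_trans)
  then show ?thesis using assms(1,2) unfolding coherent_def by blast
qed

text \<open>The path from \<open>p\<close> to \<open>t\<close> must leave \<open>p\<close>, and an
  edge leaving a place is a flow arc, since the reversed ones start at transitions.\<close>

lemma coherent_place_consumer:
  assumes "coherent C" "t \<in> C \<inter> T" "p \<in> C \<inter> P"
  obtains u where "u \<in> C" "(p, u) \<in> F"
proof -
  have "(p, t) \<in> (edges \<inter> C \<times> C)\<^sup>*" "p \<noteq> t"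
    using assms disj by (auto simp: coherent_def)
  then obtain u where "(p, u) \<in> edges \<inter> C \<times> C"
    by (meson converse_rtranclE)
  then show ?thesis using that assms(3) disj by (auto simp: edges_def)
qed

text \<open>A larger \<open>B\<close> only removes competitors from the maximality
  condition.\<close>

lemma cell_mono:
  assumes "cell B' D" "B' \<subseteq> B" "D \<inter> up B = {}"
  shows "cell B D"
proof -
  have "C \<inter> up B' = {}" if "C \<inter> up B = {}" for C
    using that up_mono[OF assms(2)] by blast
  then show ?thesis using assms(1,3) unfolding cell_def by metis
qed

text \<open>Walking backwards, \<open>C\<close> can be left only at an entry: transitions keep their
  presets in \<open>C\<close>, and a place has at most one producer.\<close>

lemma backwards_to_entry:
  assumes "coherent C" "(b, x) \<in> F\<^sup>*" "x \<in> C"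
  shows "b \<in> C \<or> (\<exists>q \<in> entry C. (b, q) \<in> F\<^sup>*)"
  using assms(2,3)
proof (induction rule: rtrancl_induct)
  case (step y x)
  show ?case
  proof (cases "y \<in> C")
    case False
    then have "x \<notin> T" using step assms(1) by (auto simp: coherent_def pre_def)
    then have "x \<in> P" using step flow by auto
    then have "pre N x \<inter> C = {}"
      using producer_unique step False by (auto simp: pre_def)
    then have "x \<in> entry C" using \<open>x \<in> P\<close> step by (auto simp: entry_def)
    then show ?thesis using step by (meson rtrancl.rtrancl_into_rtrancl)
  qed (use step in blast)
qed blast

text \<open>A causally least transition of \<open>C\<close> works: a producer of one of its input
  places would be smaller, hence lies outside \<open>C\<close>.\<close>

lemma cell_initial_transition:
  assumes "cell B C"
  obtains t where "t \<in> C \<inter> T" "pre N t \<subseteq> entry C"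
proof -
  obtain t where t: "t \<in> C \<inter> T" and least: "\<And>u. (u, t) \<in> F\<^sup>+ \<Longrightarrow> u \<notin> C \<inter> T"
    using assms wf_trancl[OF wf_flow] unfolding cell_def wf_eq_minimal by (metis ex_in_conv)
  have "q \<in> entry C" if "q \<in> pre N t" for q
  proof -
    have q: "q \<in> C" "(q, t) \<in> F" "q \<in> P"
      using that assms t flow disj by (auto simp: cell_def coherent_def pre_def)
    have "u \<notin> C" if "(u, q) \<in> F" for u
    proof -
      have "(u, t) \<in> F\<^sup>+" using that q by (meson r_into_trancl trancl_into_trancl)
      moreover have "u \<in> T" using that q flow disj by auto
      ultimately show ?thesis using least by blast
    qed
    then show ?thesis using q by (auto simp: entry_def pre_def)
  qed
  then show ?thesis using that t by blast
qed

text \<open>Lets \<open>enabled_cell\<close> infer from the entries alone that a whole cell avoids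
  everything above \<open>B\<close>.\<close>

definition shielded :: "'a set \<Rightarrow> bool" where
  "shielded B \<longleftrightarrow> (\<forall>C. coherent C \<longrightarrow> entry C \<inter> up B = {} \<longrightarrow> C \<inter> up B = {})"

text \<open>Suppose \<open>C\<close> lies partly above some \<open>y\<close> in \<open>Y\<close> but
  its entries do not. Then \<open>y\<close> is an inner place of \<open>C\<close>, so its only
  producer, a transition of \<open>D\<close>, is in \<open>C\<close> too. Maximality of
  \<open>D\<close> yields \<open>C \<subseteq> D\<close>, although \<open>y\<close> is outside
  \<open>D\<close>.\<close>

lemma shielded_exits:
  assumes "shielded B" "cell B' D" "B' \<subseteq> B" "Y \<subseteq> exits D"
  shows "shielded (B \<union> Y)"
  unfolding shielded_def
proof (intro allI impI)
  fix C assume C: "coherent C" "entry C \<inter> up (B \<union> Y) = {}"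
  then have CB: "C \<inter> up B = {}"
    using assms(1) by (auto simp: shielded_def up_Un)
  have False if "y \<in> Y" "x \<in> C" "(y, x) \<in> F\<^sup>*" for x y
  proof -
    have "y \<notin> entry C" "\<not> (\<exists>q \<in> entry C. (y, q) \<in> F\<^sup>*)"
      using C(2) that(1) by (auto simp: up_def)
    then have "y \<in> C" using backwards_to_entry[OF C(1) that(3,2)] by blast
    have "y \<in> exits D" using assms(4) that(1) by blast
    then obtain t where t: "t \<in> D \<inter> T" "(t, y) \<in> F" "y \<notin> D"
      by (auto simp: exits_def post_def)
    then have "y \<in> P" using flow disj by auto
    then have "t \<in> C"
      using \<open>y \<in> C\<close> \<open>y \<notin> entry C\<close> t producer_unique by (auto simp: entry_def pre_def)
    moreover have "C \<inter> up B' = {}" using CB up_mono[OF assms(3)] by blast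
    ultimately have "C \<subseteq> D" using assms(2) C(1) t(1) unfolding cell_def by blast
    then show False using \<open>y \<in> C\<close> t(3) by blast
  qed
  then show "C \<inter> up (B \<union> Y) = {}" using CB by (auto simp: up_Un up_def)
qed

subsection \<open>Consistency of markings\<close>

text \<open>Tokens are never taken out of this set, which makes it causally closed, unlike the
  current marking.\<close>

definition history :: "'a set \<Rightarrow> 'a set \<Rightarrow> 'a set" where
  "history m \<Theta> = m \<union> (\<Union>t \<in> \<Theta>. post N t)"

text \<open>\<open>A\<close> and \<open>B\<close> are the marked and the barred places, \<open>\<Theta>\<close> the transitions of \<open>N\<close> executed so far, and
  \<open>\<D>\<close> the cells whose transactions have fired. That no transition of a fired cell can be enabled again
  comes from the maximality of transactions, and yields that no transition of \<open>N\<close> is executed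
  twice.\<close>

definition consistent :: "'a set \<Rightarrow> 'a set \<Rightarrow> 'a set \<Rightarrow> 'a set \<Rightarrow> 'a set set \<Rightarrow> bool" where
  "consistent m A B \<Theta> \<D> \<longleftrightarrow>
     \<Theta> \<subseteq> \<Union>\<D> \<inter> T \<and> (\<forall>t \<in> \<Theta>. pre N t \<subseteq> history m \<Theta>) \<and>
     A \<subseteq> history m \<Theta> \<and>
     (\<forall>D \<in> \<D>. (\<exists>B' \<subseteq> B. cell B' D) \<and> entry D \<subseteq> history m \<Theta> \<and> (\<forall>t \<in> D \<inter> T. \<not> pre N t \<subseteq> A)) \<and>
     A \<inter> up B = {} \<and> shielded B \<and>
     (\<forall>b \<in> B. \<forall>t. (t, b) \<in> F \<longrightarrow> t \<in> \<Union>\<D> \<or> t \<in> up B)"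

text \<open>Initial places have no producer and every other place has only one, so whatever has
  occurred had all its causes occur.\<close>

lemma history_downward:
  assumes "m \<subseteq> min_places N" "\<Theta> \<subseteq> T" "\<forall>t \<in> \<Theta>. pre N t \<subseteq> history m \<Theta>"
    and "(x, y) \<in> F\<^sup>*" "y \<in> history m \<Theta> \<union> \<Theta>"
  shows "x \<in> history m \<Theta> \<union> \<Theta>"
  using assms(4,5)
proof (induction rule: rtrancl_induct)
  case (step y z)
  from step.prems consider "z \<in> \<Theta>" | "z \<in> m" | t where "t \<in> \<Theta>" "(t, z) \<in> F"
    by (auto simp: history_def post_def)
  then have "y \<in> history m \<Theta> \<union> \<Theta>"
  proof cases
    case 1 then show ?thesis using step.hyps assms(3) by (auto simp: pre_def)
  next
    case 2 then show ?thesis using step.hyps assms(1) by (auto simp: min_places_def pre_def)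
  next
    case 3
    then have "z \<in> P" using assms(2) flow disj by auto
    then show ?thesis using 3 step.hyps producer_unique by blast
  qed
  then show ?case by (rule step.IH)
qed

lemma history_transition:
  assumes "m \<subseteq> min_places N" "\<Theta> \<subseteq> T" "t \<in> T" "t \<in> history m \<Theta> \<union> \<Theta>"
  shows "t \<in> \<Theta>"
proof (rule ccontr)
  assume "t \<notin> \<Theta>"
  then have "t \<in> P" using assms flow_types by (auto simp: history_def min_places_def post_def)
  then show False using assms(3) disj by blast
qed

text \<open>Marked entries are not above \<open>B\<close>; shielding extends this to all of
  \<open>C\<close>, and then \<open>cell_mono\<close> applies.\<close>

lemma enabled_cell:
  assumes "consistent m A B \<Theta> \<D>" "cell B' C" "B' \<subseteq> B" "entry C \<subseteq> A"
  shows "cell B C"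
proof -
  have "entry C \<inter> up B = {}" using assms(1,4) by (auto simp: consistent_def)
  then have "C \<inter> up B = {}" using assms(1,2) by (auto simp: consistent_def shielded_def cell_def)
  then show ?thesis using assms cell_mono by blast
qed

text \<open>A shared transition would force \<open>C \<subseteq> D\<close> by maximality of
  \<open>D\<close>. The initial transition of \<open>C\<close> would then be an enabled transition
  of a fired cell.\<close>

lemma enabled_cell_fresh:
  assumes "consistent m A B \<Theta> \<D>" "cell B C" "entry C \<subseteq> A" "D \<in> \<D>"
  shows "C \<inter> D \<inter> T = {}"
proof (rule ccontr)
  assume "C \<inter> D \<inter> T \<noteq> {}"
  then obtain t where t: "t \<in> C \<inter> D \<inter> T" by blast
  obtain B' where B': "B' \<subseteq> B" "cell B' D" and stuck: "\<forall>t \<in> D \<inter> T. \<not> pre N t \<subseteq> A"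
    using assms(1,4) unfolding consistent_def by metis
  have "C \<inter> up B' = {}" "coherent C" using assms(2) up_mono[OF B'(1)] by (auto simp: cell_def)
  then have "C \<subseteq> D" using B'(2) t unfolding cell_def by blast
  moreover obtain u where "u \<in> C \<inter> T" "pre N u \<subseteq> entry C"
    using assms(2) by (rule cell_initial_transition)
  ultimately show False using stuck assms(3) by blast
qed

text \<open>Overlapping cells have a coherent union. Maximality applies to it even if they share
  only a place, because the union contains the transitions of both.\<close>

lemma enabled_cells_disjoint:
  assumes "consistent m A B \<Theta> \<D>"
    and "cell B1 C1" "B1 \<subseteq> B" "entry C1 \<subseteq> A"
    and "cell B2 C2" "B2 \<subseteq> B" "entry C2 \<subseteq> A"
  shows "C1 = C2 \<or> C1 \<inter> C2 = {}"
proof -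
  have *: "D \<subseteq> C" if "cell B C" "cell B D" "p \<in> C \<inter> D" for C D p
  proof -
    have "coherent (C \<union> D)" "(C \<union> D) \<inter> up B = {}" "C \<inter> T \<noteq> {}"
      using that coherent_Un by (auto simp: cell_def)
    then show ?thesis using that(1) unfolding cell_def by blast
  qed
  have "cell B C1" "cell B C2" using enabled_cell assms by blast+
  then show ?thesis using * by blast
qed

text \<open>Firing a positive transition. The first conclusion keeps regular places from receiving a
  second token; both rest on \<open>C\<close> being fresh.\<close>

lemma consistent_pos:
  assumes m: "m \<subseteq> min_places N"
    and cons: "consistent m A B \<Theta> \<D>"
    and C: "cell B' C" "B' \<subseteq> B" "entry C \<subseteq> A"
    and \<theta>: "\<theta> \<subseteq> C \<inter> T" "\<forall>t \<in> \<theta>. pre N t \<subseteq> entry C \<union> (\<Union>u\<in>\<theta>. post N u)"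
    and G: "G = entry C \<union> (\<Union>t\<in>\<theta>. post N t) - (\<Union>t\<in>\<theta>. pre N t)"
    and stuck: "\<forall>t \<in> C \<inter> T. \<not> pre N t \<subseteq> G"
    and Y: "Y \<subseteq> exits C - G"
  shows "(A - entry C) \<inter> G = {}"
    and "consistent m (A - entry C \<union> G) (B \<union> Y) (\<Theta> \<union> \<theta>) (insert C \<D>)"
proof -
  have CB: "cell B C" using enabled_cell[OF cons C] .
  have fresh: "t \<notin> D" if "D \<in> \<D>" "t \<in> C \<inter> T" for t D
    using enabled_cell_fresh[OF cons CB C(3) that(1)] that(2) by blast
  have \<Theta>: "\<Theta> \<subseteq> \<Union>\<D> \<inter> T" "\<forall>t \<in> \<Theta>. pre N t \<subseteq> history m \<Theta>" and A: "A \<subseteq> history m \<Theta>"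
    and AB: "A \<inter> up B = {}"
    and just: "\<forall>b \<in> B. \<forall>t. (t, b) \<in> F \<longrightarrow> t \<in> \<Union>\<D> \<or> t \<in> up B"
    using cons unfolding consistent_def by auto
  have fresh\<Theta>: "t \<notin> \<Theta>" if "t \<in> C \<inter> T" for t
    using fresh that \<Theta>(1) by blast
  \<comment> \<open>The history is causally closed, so \<open>t\<close> would already have been
    executed.\<close>
  have new: "q \<notin> history m \<Theta>" if "t \<in> C \<inter> T" "(t, q) \<in> F" for t q
  proof
    assume "q \<in> history m \<Theta>"
    then have "t \<in> history m \<Theta> \<union> \<Theta>"
      using history_downward[OF m _ \<Theta>(2), of t q] \<Theta>(1) that(2) by blast
    then show False using history_transition[OF m, of \<Theta> t] \<Theta>(1) that(1) fresh\<Theta> by blast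
  qed
  have G_cases: "q \<in> entry C \<or> (\<exists>t \<in> \<theta>. (t, q) \<in> F)" if "q \<in> G" for q
    using that by (auto simp: G post_def)
  show "(A - entry C) \<inter> G = {}"
    using G_cases new A \<theta>(1) by blast
  let ?A = "A - entry C \<union> G" and ?B = "B \<union> Y" and ?\<Theta> = "\<Theta> \<union> \<theta>"
  have hist: "history m ?\<Theta> = history m \<Theta> \<union> (\<Union>t\<in>\<theta>. post N t)"
    by (auto simp: history_def)
  have \<Theta>': "\<forall>t \<in> ?\<Theta>. pre N t \<subseteq> history m ?\<Theta>"
  proof
    fix t assume "t \<in> ?\<Theta>"
    then have "pre N t \<subseteq> history m \<Theta> \<or> pre N t \<subseteq> entry C \<union> (\<Union>u\<in>\<theta>. post N u)"
      using \<Theta>(2) \<theta>(2) by blast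
    moreover have "entry C \<subseteq> history m \<Theta>" using C(3) A by blast
    ultimately show "pre N t \<subseteq> history m ?\<Theta>" unfolding hist by blast
  qed
  have A': "?A \<subseteq> history m ?\<Theta>"
    using A C(3) by (auto simp: hist G)
  have entryC: "entry C \<subseteq> history m ?\<Theta>"
    using A C(3) by (auto simp: hist)
  \<comment> \<open>An older token on an inner place of \<open>C\<close> would have been produced by
    a transition of \<open>C\<close>, contrary to \<open>new\<close>.\<close>
  have AC: "q \<in> G" if "q \<in> ?A" and qC: "q \<in> C" for q
  proof (rule ccontr)
    assume "q \<notin> G"
    with that have q: "q \<in> A" "q \<notin> entry C" by auto
    then have "q \<in> m \<or> (\<exists>t \<in> T. (t, q) \<in> F)"
      using A \<Theta>(1) by (auto simp: history_def post_def)
    then have "q \<in> P" using m flow_types by (auto simp: min_places_def)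
    then obtain t where t: "t \<in> C" "(t, q) \<in> F"
      using q qC by (auto simp: entry_def pre_def)
    then have "t \<in> T" using \<open>q \<in> P\<close> flow disj by auto
    then show False using new[of t q] t q(1) A by blast
  qed
  \<comment> \<open>The missing input of \<open>t\<close> would now be supplied from outside
    \<open>D\<close>, hence be an entry of \<open>D\<close>; but entries of fired cells are already
    in the history.\<close>
  have old: "\<not> pre N t \<subseteq> ?A" if D: "D \<in> \<D>" and t: "t \<in> D \<inter> T" for D t
  proof
    assume sub: "pre N t \<subseteq> ?A"
    have "\<not> pre N t \<subseteq> A" and coh: "coherent D" and entryD: "entry D \<subseteq> history m \<Theta>"
      using cons D t unfolding consistent_def cell_def by blast+
    then obtain q where q: "q \<in> pre N t" "q \<notin> A" by blast
    then have "q \<in> G" "q \<notin> entry C" using sub C(3) by auto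
    then have "\<exists>u \<in> \<theta>. (u, q) \<in> F" using G_cases[of q] by blast
    then obtain u where u: "u \<in> \<theta>" "(u, q) \<in> F" by blast
    then have "u \<notin> D" using fresh[OF D] \<theta>(1) by blast
    moreover have "q \<in> D" "q \<in> P"
      using q t coh flow disj by (auto simp: coherent_def pre_def)
    ultimately have "q \<in> entry D" using u producer_unique by (auto simp: entry_def pre_def)
    then show False using entryD new[of u q] u \<theta>(1) by blast
  qed
  have cells: "(\<exists>B' \<subseteq> ?B. cell B' D) \<and> entry D \<subseteq> history m ?\<Theta> \<and> (\<forall>t \<in> D \<inter> T. \<not> pre N t \<subseteq> ?A)"
    if "D \<in> insert C \<D>" for D
  proof (cases "D \<in> \<D>")
    case True
    then have "(\<exists>B' \<subseteq> B. cell B' D) \<and> entry D \<subseteq> history m \<Theta>"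
      using cons unfolding consistent_def by blast
    then show ?thesis using old[OF True] by (auto simp: hist)
  next
    case False
    then have [simp]: "D = C" using that by blast
    have "\<not> pre N t \<subseteq> ?A" if "t \<in> C \<inter> T" for t
    proof
      assume "pre N t \<subseteq> ?A"
      moreover have "pre N t \<subseteq> C" using that C(1) by (auto simp: cell_def coherent_def)
      ultimately have "pre N t \<subseteq> G" using AC by blast
      then show False using stuck that by blast
    qed
    then show ?thesis using C entryC by auto
  qed
  \<comment> \<open>A new token above \<open>B\<close> is either itself barred, which the clause on
    producers of barred places excludes, or its producer in \<open>C\<close> is above
    \<open>B\<close>.\<close>
  have noB: "q \<notin> up B" if "q \<in> ?A" for q
  proof
    assume up: "q \<in> up B"
    then have "q \<notin> A" using AB by blast
    then have "\<exists>t \<in> \<theta>. (t, q) \<in> F" using G_cases[of q] that C(3) by blast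
    then obtain t where t: "t \<in> \<theta>" "(t, q) \<in> F" by blast
    then have tC: "t \<in> C \<inter> T" and tB: "t \<notin> up B" using \<theta>(1) CB by (auto simp: cell_def)
    then have "q \<in> P" using t flow disj by auto
    from up obtain b where b: "b \<in> B" "(b, q) \<in> F\<^sup>*" by (auto simp: up_def)
    from b(2) show False
    proof (cases rule: rtranclE)
      case base
      then show False using just b(1) t(2) tB fresh tC by blast
    next
      case (step y)
      then have "y = t" using producer_unique t \<open>q \<in> P\<close> by blast
      then show False using step b(1) tB by (auto simp: up_def)
    qed
  qed
  \<comment> \<open>A token above \<open>y\<close> in \<open>Y\<close> means that the producer of
    \<open>y\<close> ran in \<open>\<theta>\<close>. No transition of \<open>\<theta>\<close>
    consumes an exit, so \<open>y\<close> would be in \<open>G\<close>.\<close>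
  have noY: "q \<notin> up Y" if "q \<in> ?A" for q
  proof
    assume "q \<in> up Y"
    then obtain y t where y: "y \<in> Y" "(y, q) \<in> F\<^sup>*" and t: "t \<in> C \<inter> T" "(t, y) \<in> F"
      using Y by (auto simp: up_def exits_def post_def)
    then have "(t, q) \<in> F\<^sup>*" by (meson converse_rtrancl_into_rtrancl)
    then have "t \<in> history m ?\<Theta> \<union> ?\<Theta>"
      using history_downward[OF m _ \<Theta>', of t q] A' that \<Theta>(1) \<theta>(1) by blast
    then have "t \<in> ?\<Theta>" using history_transition[OF m, of ?\<Theta> t] \<Theta>(1) \<theta>(1) t(1) by blast
    then have "t \<in> \<theta>" using fresh\<Theta> t(1) by blast
    moreover have "pre N u \<subseteq> C" if "u \<in> \<theta>" for u
      using that \<theta>(1) C(1) by (auto simp: cell_def coherent_def)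
    ultimately have "y \<in> G" using t(2) y(1) Y by (auto simp: G post_def exits_def)
    then show False using y(1) Y by blast
  qed
  have shielded: "shielded ?B"
    using shielded_exits[OF _ C(1,2), of Y] cons Y by (auto simp: consistent_def)
  have producers: "t \<in> \<Union>(insert C \<D>) \<or> t \<in> up ?B" if "b \<in> ?B" "(t, b) \<in> F" for b t
  proof (cases "b \<in> B")
    case True then show ?thesis using just that by (auto simp: up_Un)
  next
    case False
    then have "b \<in> exits C" using that Y by blast
    then obtain u where "u \<in> C \<inter> T" "(u, b) \<in> F" by (auto simp: exits_def post_def)
    moreover from this have "b \<in> P" using flow disj by auto
    ultimately show ?thesis using producer_unique that(2) by blast
  qed
  have "?A \<inter> up ?B = {}" using noB noY by (auto simp: up_Un)
  moreover have "?\<Theta> \<subseteq> \<Union>(insert C \<D>) \<inter> T" using \<Theta>(1) \<theta>(1) by blast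
  ultimately show "consistent m ?A ?B ?\<Theta> (insert C \<D>)"
    unfolding consistent_def
    by (intro conjI \<Theta>' A' shielded ballI[OF cells] ballI[OF allI[OF impI[OF producers]]])
qed

text \<open>All of \<open>Y\<close> is above the barred \<open>p\<close>, so \<open>up B\<close>
  does not change; only shielding and the clause on producers need an argument.\<close>

lemma consistent_neg:
  assumes cons: "consistent m A B \<Theta> \<D>"
    and C: "cell B' C" "B' \<subseteq> B"
    and p: "p \<in> B" "p \<in> C"
    and Y: "Y \<subseteq> exits C" "Y \<subseteq> up {p}"
  shows "consistent m A (B \<union> Y) \<Theta> \<D>"
proof -
  have "up {p} \<subseteq> up B" using p by (intro up_mono) auto
  then have "Y \<subseteq> up B" using Y(2) by blast
  then have "up Y \<subseteq> up B" using up_steps unfolding up_def[of Y] by blast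
  then have up: "up (B \<union> Y) = up B" by (auto simp: up_Un)
  have shielded: "shielded (B \<union> Y)"
    using shielded_exits[OF _ C Y(1)] cons by (auto simp: consistent_def)
  \<comment> \<open>As \<open>p\<close> is in \<open>C\<close> and \<open>y\<close> is not, the path
    from \<open>p\<close> is nontrivial and reaches \<open>y\<close> through its only
    producer.\<close>
  have producers: "t \<in> up B" if "y \<in> Y" "(t, y) \<in> F" for y t
  proof -
    have "(p, y) \<in> F\<^sup>*" "y \<in> exits C" using that(1) Y by (auto simp: up_def)
    then have "y \<in> P" "y \<noteq> p" using p flow_types by (auto simp: exits_def post_def)
    obtain u where "(p, u) \<in> F\<^sup>*" "(u, y) \<in> F"
      using \<open>(p, y) \<in> F\<^sup>*\<close> \<open>y \<noteq> p\<close> by (metis rtranclE)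
    then show ?thesis using producer_unique that(2) \<open>y \<in> P\<close> p(1) by (auto simp: up_def)
  qed
  have "\<forall>b \<in> B \<union> Y. \<forall>t. (t, b) \<in> F \<longrightarrow> t \<in> \<Union>\<D> \<or> t \<in> up B"
    using cons producers by (auto simp: consistent_def)
  moreover have "\<exists>B' \<subseteq> B \<union> Y. cell B' D" if "D \<in> \<D>" for D
    using cons that by (meson consistent_def le_supI1)
  ultimately show ?thesis
    using cons shielded unfolding consistent_def up by simp
qed

subsection \<open>The nets of the recursion\<close>

text \<open>The nets whose encodings get loaded once the places of \<open>B\<close> have been removed. Only coherent sets
  meeting \<open>X\<close> in a transition are compared with \<open>X\<close>, because \<open>X\<close> contains the exit places of a cell,
  which may belong to larger coherent sets of \<open>N\<close>.\<close>

definition component :: "'a set \<Rightarrow> 'a net \<Rightarrow> bool" where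
  "component B M \<longleftrightarrow> (\<exists>X. M = subnet N X \<and> (\<forall>t \<in> X \<inter> T. pre N t \<subseteq> X \<and> post N t \<subseteq> X) \<and>
     X \<inter> up B = {} \<and> (\<forall>C t. coherent C \<and> C \<inter> up B = {} \<and> t \<in> C \<inter> X \<inter> T \<longrightarrow> C \<subseteq> X))"

lemma coherent_subset:
  assumes "coherent C" "t \<in> C \<inter> T"
  shows "C \<subseteq> P \<union> T"
proof
  fix x assume "x \<in> C"
  then have "(t, x) \<in> (edges \<inter> C \<times> C)\<^sup>*" using assms by (auto simp: coherent_def)
  then show "x \<in> P \<union> T"
    by (cases rule: rtranclE) (use assms(2) flow in \<open>auto simp: edges_def\<close>)
qed

text \<open>Input arcs within \<open>X\<close> can be traversed both ways, so a transition and its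
  preset share a component.\<close>

lemma coherent_strong_component:
  assumes X: "\<forall>t \<in> X \<inter> T. pre N t \<subseteq> X" and "x \<in> X"
    and C: "C = {y. (x, y) \<in> (edges \<inter> X \<times> X)\<^sup>* \<and> (y, x) \<in> (edges \<inter> X \<times> X)\<^sup>*}"
  shows "coherent C" "C \<subseteq> X"
proof -
  let ?R = "edges \<inter> X \<times> X"
  show CX: "C \<subseteq> X"
    using \<open>x \<in> X\<close> by (auto simp: C elim: rtranclE)
  have "pre N t \<subseteq> C" if "t \<in> C \<inter> T" for t
  proof
    fix p assume p: "p \<in> pre N t"
    then have "p \<in> P" using that flow_types by (auto simp: pre_def)
    then have "(p, t) \<in> ?R" "(t, p) \<in> ?R"
      using p that X CX by (auto simp: edges_def pre_def)
    then show "p \<in> C"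
      using that by (auto simp: C intro: rtrancl_into_rtrancl converse_rtrancl_into_rtrancl)
  qed
  moreover have "(y, z) \<in> (edges \<inter> C \<times> C)\<^sup>*" if "y \<in> C" "z \<in> C" for y z
  proof -
    have "(y, z) \<in> ?R\<^sup>*" "(z, y) \<in> ?R\<^sup>*" using that by (auto simp: C intro: rtrancl_trans)
    moreover have "C = {u. (y, u) \<in> ?R\<^sup>* \<and> (u, y) \<in> ?R\<^sup>*}"
      using that(1) by (auto simp: C intro: rtrancl_trans)
    ultimately have "(y, z) \<in> (?R \<inter> C \<times> C)\<^sup>*" by (rule rtrancl_within_component)
    then show ?thesis using rtrancl_mono[of "?R \<inter> C \<times> C" "edges \<inter> C \<times> C"] by blast
  qed
  ultimately show "coherent C" by (simp add: coherent_def)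
qed

lemma coherent_subset_strong_component:
  assumes "coherent C" "C \<subseteq> X" "x \<in> C" "y \<in> C"
  shows "(x, y) \<in> (edges \<inter> X \<times> X)\<^sup>*"
proof -
  have "(edges \<inter> C \<times> C)\<^sup>* \<subseteq> (edges \<inter> X \<times> X)\<^sup>*" using assms(2) by (auto intro!: rtrancl_mono)
  then show ?thesis using assms by (auto simp: coherent_def)
qed

text \<open>By maximality \<open>C\<close> contains the strong component \<open>D\<close> of
  \<open>x\<close> in the graph outside \<open>up B\<close>. The path through \<open>y\<close>
  avoids \<open>up B\<close> because its end \<open>z\<close> does, and \<open>C\<close> leads back
  from \<open>z\<close> to \<open>x\<close>.\<close>

lemma cell_convex:
  assumes C: "cell B C" and xz: "x \<in> C" "z \<in> C" and y: "(x, y) \<in> F\<^sup>*" "(y, z) \<in> F\<^sup>*"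
  shows "y \<in> C"
proof -
  let ?X = "- up B"
  let ?R = "edges \<inter> ?X \<times> ?X"
  define D where "D = {v. (x, v) \<in> ?R\<^sup>* \<and> (v, x) \<in> ?R\<^sup>*}"
  have CX: "C \<subseteq> ?X" and coh: "coherent C" using C by (auto simp: cell_def)
  have path: "(u, v) \<in> ?R\<^sup>*" if "(u, v) \<in> F\<^sup>*" "v \<in> ?X" for u v
    using that
  proof (induction rule: rtrancl_induct)
    case (step v w)
    then have "v \<in> ?X" using up_step by blast
    then have "(v, w) \<in> ?R" using step by (auto simp: edges_def)
    then show ?case using step.IH \<open>v \<in> ?X\<close> by (meson rtrancl.rtrancl_into_rtrancl)
  qed simp
  have "coherent D" "D \<subseteq> ?X"
    using coherent_strong_component[OF _ _ D_def] CX xz(1) up_step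
    by (fastforce simp: pre_def)+
  moreover have "C \<subseteq> D"
    using coherent_subset_strong_component[OF coh CX] xz(1) by (auto simp: D_def)
  moreover obtain t where "t \<in> C \<inter> T" using C by (auto simp: cell_def)
  ultimately have "D \<subseteq> C" using C unfolding cell_def by blast
  have "y \<in> ?X" using up_steps[OF _ y(2)] CX xz(2) by blast
  then have "(x, y) \<in> ?R\<^sup>*" "(y, z) \<in> ?R\<^sup>*" using path y CX xz(2) by auto
  moreover have "(z, x) \<in> ?R\<^sup>*" using coherent_subset_strong_component[OF coh CX xz(2,1)] .
  ultimately have "y \<in> D" by (auto simp: D_def intro: rtrancl_trans)
  then show ?thesis using \<open>D \<subseteq> C\<close> by blast
qed

section \<open>Cell nets and their boundary places\<close>

definition extent :: "'a set \<Rightarrow> 'a set" where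
  "extent C = C \<union> (\<Union>t \<in> C \<inter> T. post N t)"

lemma extent_transitions: "extent C \<inter> T = C \<inter> T"
proof -
  have "z \<notin> T" if "t \<in> T" "(t, z) \<in> F" for t z
    using that flow_types(1)[of t z] disj by blast
  then show ?thesis by (auto simp: extent_def post_def)
qed

lemma cell_net_extent: "cell_net N C = subnet N (extent C)"
  by (simp add: cell_net_def extent_def)

lemma transitions_cell_net: "transitions (cell_net N C) = C \<inter> T"
  using extent_transitions by (auto simp: cell_net_extent subnet_def)

lemma post_cell_net: "t \<in> C \<inter> T \<Longrightarrow> post (cell_net N C) t = post N t"
  by (auto simp: cell_net_extent subnet_def post_def extent_def)

lemma pre_cell_net: "coherent C \<Longrightarrow> t \<in> C \<inter> T \<Longrightarrow> pre (cell_net N C) t = pre N t"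
  by (auto simp: cell_net_extent subnet_def pre_def extent_def coherent_def)

text \<open>Places added by the postsets have a producer in the cell net, and producers of places
  within the extent are transitions of \<open>C\<close>.\<close>

lemma cell_min_entry: "cell_min N C = entry C"
proof (intro equalityI subsetI)
  fix p assume "p \<in> cell_min N C"
  then have p: "p \<in> P" "p \<in> extent C" and "\<forall>t \<in> extent C. (t, p) \<notin> F"
    by (auto simp: cell_min_def min_places_def cell_net_extent subnet_def pre_def)
  moreover from this have "p \<in> C" by (auto simp: extent_def post_def)
  ultimately show "p \<in> entry C" by (auto simp: entry_def extent_def pre_def)
next
  fix p assume p: "p \<in> entry C"
  have "t \<in> C" if "t \<in> extent C" "(t, p) \<in> F" for t
    using that p flow_types(1)[of t p] extent_transitions by (auto simp: entry_def)
  then show "p \<in> cell_min N C"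
    using p by (auto simp: cell_min_def min_places_def cell_net_extent subnet_def pre_def
        entry_def extent_def)
qed

text \<open>Each place of \<open>C\<close> has a consumer in \<open>C\<close>, so a final place must
  come from the added postsets.\<close>

lemma cell_max_exits:
  assumes "cell B C"
  shows "cell_max N C \<subseteq> exits C"
proof
  fix b assume "b \<in> cell_max N C"
  then have b: "b \<in> P" "b \<in> extent C" "\<forall>z \<in> extent C. (b, z) \<notin> F"
    by (auto simp: cell_max_def max_places_def cell_net_extent subnet_def post_def)
  moreover obtain t where "t \<in> C \<inter> T" "coherent C" using assms by (auto simp: cell_def)
  ultimately have "b \<notin> C"
    by (metis IntI UnI1 coherent_place_consumer extent_def)
  then show "b \<in> exits C" using b by (auto simp: exits_def extent_def)
qed

lemma component_self: "component {} N"
proof -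
  have "N = subnet N (P \<union> T)"
  proof -
    have "F \<inter> (P \<union> T) \<times> (P \<union> T) = F" using flow by auto
    then show ?thesis by (cases N) (auto simp: subnet_def)
  qed
  moreover have "C \<subseteq> P \<union> T" if "coherent C" "t \<in> C \<inter> T" for C t
    using coherent_subset[OF that] .
  moreover have "pre N t \<subseteq> P \<union> T \<and> post N t \<subseteq> P \<union> T" for t
    using flow by (auto simp: pre_def post_def)
  ultimately show ?thesis
    unfolding component_def by (intro exI[of _ "P \<union> T"]) (auto simp: up_def)
qed

text \<open>Cells computed in \<open>M\<close> are cells of \<open>N\<close> relative to
  \<open>B\<close>: a competing coherent set is first absorbed by \<open>X\<close> and then by the
  strong component in \<open>X\<close>.\<close>

lemma component_cell:
  assumes M: "component B M" and "C \<in> BC M"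
  shows "cell B C" "cell_net M C = cell_net N C" "extent C \<inter> up B = {}"
proof -
  obtain X where X: "M = subnet N X" "\<forall>t \<in> X \<inter> T. pre N t \<subseteq> X \<and> post N t \<subseteq> X"
    "X \<inter> up B = {}" "\<forall>C t. coherent C \<and> C \<inter> up B = {} \<and> t \<in> C \<inter> X \<inter> T \<longrightarrow> C \<subseteq> X"
    using M unfolding component_def by (elim exE conjE) (rule that)
  obtain t where t: "t \<in> X \<inter> T" "C = cell_of M t"
    using assms(2) X(1) by (auto simp: BC_def subnet_def)
  let ?R = "edges \<inter> X \<times> X"
  have "flow M \<union> (flow M \<inter> (places M \<times> transitions M))\<inverse> = ?R"
    by (auto simp: X(1) subnet_def edges_def)
  then have C: "C = {y. (t, y) \<in> ?R\<^sup>* \<and> (y, t) \<in> ?R\<^sup>*}"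
    by (simp add: t(2) cell_of_def cell_le_alt)
  have coh: "coherent C" and CX: "C \<subseteq> X"
    using coherent_strong_component[OF _ _ C] X(2) t(1) by blast+
  have "D \<subseteq> C" if D: "coherent D" "D \<inter> up B = {}" "u \<in> D \<inter> C \<inter> T" for D u
  proof
    fix x assume "x \<in> D"
    have "u \<in> D \<inter> X \<inter> T" using D(3) CX by blast
    then have "D \<subseteq> X" using X(4) D(1,2) by metis
    then have "(u, x) \<in> ?R\<^sup>*" "(x, u) \<in> ?R\<^sup>*"
      using coherent_subset_strong_component[OF D(1)] D(3) \<open>x \<in> D\<close> by blast+
    then show "x \<in> C" using D(3) by (auto simp: C intro: rtrancl_trans)
  qed
  moreover have "C \<inter> T \<noteq> {}" using t(1) by (auto simp: C)
  ultimately show "cell B C" using coh CX X(3) unfolding cell_def by blast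
  have ext: "extent C \<subseteq> X" using CX X(2) by (auto simp: extent_def)
  then show "extent C \<inter> up B = {}" using X(3) by blast
  have "post M u = post N u" if "u \<in> C \<inter> T" for u
    using that CX X(2) by (auto simp: X(1) subnet_def post_def)
  moreover have "C \<inter> transitions M = C \<inter> T" using CX by (auto simp: X(1) subnet_def)
  ultimately have "C \<union> (\<Union>t \<in> C \<inter> transitions M. post M t) = extent C"
    by (auto simp: extent_def)
  then have "cell_net M C = subnet M (extent C)" by (simp add: cell_net_def)
  also have "\<dots> = cell_net N C"
    using ext by (auto simp: cell_net_extent X(1) subnet_def)
  finally show "cell_net M C = cell_net N C" .
qed

text \<open>Identifies the inductive removal with deleting the causal future of \<open>p\<close>,
  which ties the recursion to \<open>up\<close>.\<close>

lemma removal_elems_cell_net: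
  assumes C: "cell B C" and p: "p \<in> entry C"
  shows "removal_elems (cell_net N C) p = extent C - up {p}"
proof (intro equalityI subsetI)
  have coh: "coherent C" using C by (simp add: cell_def)
  have pP: "p \<in> P" "p \<in> C" using p by (auto simp: entry_def)
  fix x assume "x \<in> removal_elems (cell_net N C) p"
  then show "x \<in> extent C - up {p}"
  proof (induction rule: removal_elems.induct)
    case (removal_min q)
    then have q: "q \<in> entry C" using cell_min_entry by (simp add: cell_min_def)
    \<comment> \<open>By convexity a path from \<open>p\<close> to another entry \<open>q\<close>
      would enter \<open>q\<close> from an element of \<open>C\<close>.\<close>
    have "q \<notin> up {p}"
    proof
      assume "q \<in> up {p}"
      then have "(p, q) \<in> F\<^sup>*" by (simp add: up_def)
      then obtain u where "(p, u) \<in> F\<^sup>*" "(u, q) \<in> F"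
        using removal_min(2) by (metis rtranclE)
      moreover from this have "u \<in> C"
        using cell_convex[OF C, of p q u] pP q by (auto simp: entry_def)
      ultimately show False using q by (auto simp: entry_def pre_def)
    qed
    then show ?case using q by (auto simp: entry_def extent_def)
  next
    case (removal_trans t)
    then have t: "t \<in> C \<inter> T" by (simp add: transitions_cell_net)
    have "t \<notin> up {p}"
    proof
      assume "t \<in> up {p}"
      then have "(p, t) \<in> F\<^sup>*" by (simp add: up_def)
      moreover have "t \<noteq> p" using t pP disj by blast
      ultimately obtain u where "(p, u) \<in> F\<^sup>*" "(u, t) \<in> F" by (metis rtranclE)
      then have "u \<in> up {p}" "u \<in> pre (cell_net N C) t"
        using pre_cell_net[OF coh t] by (auto simp: up_def pre_def)
      then show False using removal_trans(2) by blast
    qed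
    then show ?case using t by (auto simp: extent_def)
  next
    case (removal_post t q)
    then have t: "t \<in> C \<inter> T" "(t, q) \<in> F"
      using post_cell_net[of t C] by (auto simp: transitions_cell_net post_def)
    have "q \<notin> up {p}"
    proof
      assume "q \<in> up {p}"
      then have "(p, q) \<in> F\<^sup>*" by (simp add: up_def)
      moreover have "q \<noteq> p" using t p by (auto simp: entry_def pre_def)
      ultimately obtain u where "(p, u) \<in> F\<^sup>*" "(u, q) \<in> F" by (metis rtranclE)
      moreover from this have "u = t" using t producer_unique flow_types by blast
      ultimately show False using removal_post.IH by (auto simp: up_def)
    qed
    then show ?case using t by (auto simp: extent_def post_def)
  qed
next
  have coh: "coherent C" using C by (simp add: cell_def)
  have sub: "extent C \<subseteq> P \<union> T"
    using coherent_subset[OF coh] C flow by (auto simp: extent_def post_def cell_def)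
  fix x assume "x \<in> extent C - up {p}"
  then show "x \<in> removal_elems (cell_net N C) p"
  \<comment> \<open>Causes of an element outside the future of \<open>p\<close> are also outside it,
    so causal induction rebuilds the element from the surviving minimal places.\<close>
  proof (induction x rule: wf_induct_rule[OF wf_flow])
    case (1 x)
    have IH: "y \<in> removal_elems (cell_net N C) p" if "(y, x) \<in> F" "y \<in> extent C" for y
      using 1 that up_step by blast
    show ?case
    proof (cases "x \<in> T")
      case True
      then have x: "x \<in> C \<inter> T" using 1(2) extent_transitions by blast
      have "\<forall>q \<in> pre (cell_net N C) x. q \<in> removal_elems (cell_net N C) p"
        unfolding pre_cell_net[OF coh x] using IH x coh by (auto simp: pre_def coherent_def extent_def)
      then show ?thesis using x by (intro removal_trans) (simp_all add: transitions_cell_net)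
    next
      case False
      then have xP: "x \<in> P" using 1(2) sub by blast
      show ?thesis
      proof (cases "\<exists>u \<in> extent C. (u, x) \<in> F")
        case True
        then obtain u where u: "u \<in> extent C" "(u, x) \<in> F" by blast
        then have "u \<in> C \<inter> T" using xP flow_types extent_transitions by blast
        then show ?thesis
          using IH[OF u(2,1)] u(2) post_cell_net[of u C] removal_post[of u "cell_net N C" p x]
          by (auto simp: transitions_cell_net post_def)
      next
        case False
        then have "x \<in> min_places (cell_net N C)"
          using xP 1(2) by (auto simp: min_places_def cell_net_extent subnet_def pre_def)
        moreover have "x \<noteq> p" using 1(2) subset_up by blast
        ultimately show ?thesis by (rule removal_min)
      qed
    qed
  qed
qed

text \<open>The witness is the extent without the future of \<open>p\<close>. A competing coherent
  set is contained in \<open>C\<close> by maximality and avoids that future by assumption.\<close>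

lemma component_removal:
  assumes M: "component B M" and C: "C \<in> BC M" and p: "p \<in> entry C"
  shows "component (insert p B) (cell_net N C \<ominus> p)"
proof -
  let ?X = "extent C - up {p}"
  have cell: "cell B C" and ext: "extent C \<inter> up B = {}" using component_cell[OF M C] by auto
  have up: "up (insert p B) = up {p} \<union> up B" by (auto simp: up_def)
  have "cell_net N C \<ominus> p = subnet N ?X"
    unfolding removal_def removal_elems_cell_net[OF cell p]
    by (auto simp: cell_net_extent subnet_def)
  moreover have "pre N t \<subseteq> ?X \<and> post N t \<subseteq> ?X" if t: "t \<in> ?X \<inter> T" for t
  proof
    have tC: "t \<in> C \<inter> T" using t extent_transitions by blast
    then have "pre N t \<subseteq> C" using cell by (simp add: cell_def coherent_def)
    moreover have "q \<notin> up {p}" if "q \<in> pre N t" for q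
      using that t up_step by (auto simp: pre_def)
    ultimately show "pre N t \<subseteq> ?X" by (auto simp: extent_def)
    show "post N t \<subseteq> ?X"
    proof
      fix q assume q: "q \<in> post N t"
      then have "(t, q) \<in> F" "q \<in> P" using tC flow_types by (auto simp: post_def)
      have "q \<notin> up {p}"
      proof
        assume "q \<in> up {p}"
        then have "(p, q) \<in> F\<^sup>*" by (simp add: up_def)
        moreover have "q \<noteq> p" using tC \<open>(t, q) \<in> F\<close> p by (auto simp: entry_def pre_def)
        ultimately obtain u where "(p, u) \<in> F\<^sup>*" "(u, q) \<in> F" by (metis rtranclE)
        moreover from this have "u = t" using \<open>(t, q) \<in> F\<close> \<open>q \<in> P\<close> producer_unique by blast
        ultimately show False using t by (auto simp: up_def)
      qed
      then show "q \<in> ?X" using q tC by (auto simp: extent_def)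
    qed
  qed
  moreover have "?X \<inter> up (insert p B) = {}" using ext up by blast
  moreover have "D \<subseteq> ?X"
    if D: "coherent D" "D \<inter> up (insert p B) = {}" "t \<in> D \<inter> ?X \<inter> T" for D t
  proof -
    have "t \<in> D \<inter> C \<inter> T" using D(3) extent_transitions by blast
    then have "D \<subseteq> C" using cell D(1,2) up unfolding cell_def by blast
    then show ?thesis using D(2) up by (auto simp: extent_def)
  qed
  ultimately show ?thesis unfolding component_def by (intro exI[of _ ?X]) blast
qed

section \<open>Encoded transitions in terms of cells of \<open>N\<close>\<close>

lemma component_finite:
  assumes "component B M"
  shows "finite_net M" "places M \<inter> transitions M = {}"
  using assms fin disj by (auto simp: component_def finite_net_def subnet_def)

text \<open>Delivers a transaction in the form that \<open>consistent_pos\<close> assumes; the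
  preset condition comes from its firing sequence.\<close>

lemma T_pos_cases:
  assumes M: "component B M" and tr: "tr \<in> T_pos M"
  obtains C \<theta> G Y where
    "cell B C" "\<theta> \<subseteq> C \<inter> T" "\<forall>t \<in> \<theta>. pre N t \<subseteq> entry C \<union> (\<Union>u\<in>\<theta>. post N u)"
    "G = entry C \<union> (\<Union>t\<in>\<theta>. post N t) - (\<Union>t\<in>\<theta>. pre N t)"
    "\<forall>t \<in> C \<inter> T. \<not> pre N t \<subseteq> G" "Y \<subseteq> exits C - G"
    "tr = (Reg ` entry C, DNet {||} (enc_bag G Y))"
proof -
  obtain C \<theta> where C: "C \<in> BC M" and tra: "transaction M \<theta> C"
    and tr: "tr = (Reg ` cell_min M C, DNet {||}
      (enc_bag (transaction_max M \<theta> C) (cell_max M C - transaction_max M \<theta> C)))"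
    using tr by (auto simp: T_pos_def)
  have cell: "cell B C" and net: "cell_net M C = cell_net N C" using component_cell[OF M C] by auto
  then have coh: "coherent C" by (simp add: cell_def)
  have min: "cell_min M C = entry C" using net cell_min_entry by (simp add: cell_min_def)
  have max: "cell_max M C \<subseteq> exits C" using net cell_max_exits[OF cell] by (simp add: cell_max_def)
  let ?K = "cell_net N C"
  have proc: "max_det_process ?K (entry C) \<theta>" using tra net min by (simp add: transaction_def)
  then have \<theta>: "\<theta> \<subseteq> C \<inter> T"
    by (simp add: max_det_process_def det_process_def transitions_cell_net)
  let ?G = "entry C \<union> (\<Union>t\<in>\<theta>. post N t) - (\<Union>t\<in>\<theta>. pre N t)"
  have posts: "(\<Union>t\<in>\<theta>. post ?K t) = (\<Union>t\<in>\<theta>. post N t)"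
    using \<theta> post_cell_net by (intro SUP_cong) blast+
  have pres: "(\<Union>t\<in>\<theta>. pre ?K t) = (\<Union>t\<in>\<theta>. pre N t)"
    using \<theta> pre_cell_net[OF coh] by (intro SUP_cong) blast+
  have G: "final_places ?K (entry C) \<theta> = ?G" by (simp add: final_places_def posts pres)
  then have tm: "transaction_max M \<theta> C = ?G" by (simp add: transaction_max_def net min)
  have "\<forall>t \<in> C \<inter> T. \<not> pre N t \<subseteq> ?G"
    using proc pre_cell_net[OF coh] by (auto simp: max_det_process_def transitions_cell_net G)
  moreover have "pre N t \<subseteq> entry C \<union> (\<Union>u\<in>\<theta>. post N u)" if t: "t \<in> \<theta>" for t
  proof -
    obtain ts m' where "set ts = \<theta>" "fires ?K (entry C) ts m'"
      using proc by (auto simp: max_det_process_def det_process_def)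
    then have "pre ?K t \<subseteq> entry C \<union> (\<Union>u\<in>\<theta>. post ?K u)" using fires_pre t by metis
    moreover have "pre ?K t = pre N t" using pre_cell_net[OF coh] \<theta> t by blast
    ultimately show ?thesis by (simp only: posts)
  qed
  moreover have "cell_max M C - ?G \<subseteq> exits C - ?G" using max by blast
  ultimately show ?thesis
    using that[of C \<theta> ?G "cell_max M C - ?G"] cell \<theta> by (simp add: tr min tm)
qed

text \<open>\<open>Y \<subseteq> up {p}\<close> holds because a final place of the cell net that is
  not above \<open>p\<close> survives the removal and stays final.\<close>

lemma T_neg_cases:
  assumes M: "component B M" and tr: "tr \<in> T_neg M"
  obtains C p Y M' where
    "cell B C" "p \<in> entry C" "Y \<subseteq> exits C" "Y \<subseteq> up {p}" "component (insert p B) M'"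
    "tr = ({Bar p}, DNet (dtrans (encode M' {})) (enc_bag {} Y))"
proof -
  obtain C p T' b0 where C: "C \<in> BC M" and p: "p \<in> cell_min M C"
    and T': "encode (cell_net M C \<ominus> p) {} = DNet T' b0"
    and tr: "tr = ({Bar p}, DNet T' (enc_bag {} (cell_max M C - max_places (cell_net M C \<ominus> p))))"
    using tr by (auto simp: T_neg_def)
  have cell: "cell B C" and net: "cell_net M C = cell_net N C" using component_cell[OF M C] by auto
  have p: "p \<in> entry C" using p net cell_min_entry by (simp add: cell_min_def)
  let ?Y = "cell_max M C - max_places (cell_net M C \<ominus> p)"
  have max: "cell_max M C = cell_max N C" using net by (simp add: cell_max_def)
  then have "?Y \<subseteq> exits C" using cell_max_exits[OF cell] by auto
  moreover have "?Y \<subseteq> up {p}"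
    unfolding max net removal_def removal_elems_cell_net[OF cell p]
    by (auto simp: cell_max_def max_places_def cell_net_extent subnet_def post_def)
  ultimately show ?thesis
    using that[of C p ?Y "cell_net N C \<ominus> p"] cell p component_removal[OF M C p] T'
    by (simp add: tr net)
qed

subsection \<open>The invariant of the encoding\<close>

definition marked :: "'a dplace dnet \<Rightarrow> 'a set" where
  "marked D = {q. dmark D (Reg q) \<noteq> 0}"

definition barred :: "'a dplace dnet \<Rightarrow> 'a set" where
  "barred D = {p. dmark D (Bar p) \<noteq> 0}"

text \<open>Each transition may come from a net with its own removed set \<open>B'\<close>;
  requiring only \<open>B' \<subseteq> B\<close> makes the property stable as more places become
  barred.\<close>

definition loaded :: "'a set \<Rightarrow> 'a dplace dtransition \<Rightarrow> bool" where
  "loaded B tr \<longleftrightarrow> (\<exists>B' M. B' \<subseteq> B \<and> component B' M \<and> tr \<in> T_pos M \<union> T_neg M)"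

text \<open>The value restrictions make the bag recoverable from the sets \<open>marked D\<close>
  and \<open>barred D\<close>.\<close>

definition invariant :: "'a set \<Rightarrow> 'a dplace dnet \<Rightarrow> bool" where
  "invariant m D \<longleftrightarrow> (\<exists>\<Theta> \<D>. consistent m (marked D) (barred D) \<Theta> \<D>) \<and>
     (\<forall>tr \<in> fset (dtrans D). loaded (barred D) tr) \<and>
     (\<forall>q. dmark D (Reg q) \<in> {0, 1}) \<and> (\<forall>p. dmark D (Bar p) \<in> {0, \<infinity>})"

lemma loaded_mono: "loaded B tr \<Longrightarrow> B \<subseteq> B' \<Longrightarrow> loaded B' tr"
  unfolding loaded_def by (meson order_trans)

lemma invariant_encode:
  assumes "m \<subseteq> min_places N"
  shows "invariant m (encode N m)"
proof -
  have enc: "fset (dtrans (encode N m)) = T_pos N \<union> T_neg N" "dmark (encode N m) = enc_bag m {}"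
    using encode_eq[OF fin disj] .
  have "marked (encode N m) = m" "barred (encode N m) = {}"
    by (auto simp: marked_def barred_def enc enc_bag_def)
  moreover have "consistent m m {} {} {}"
    by (auto simp: consistent_def history_def shielded_def up_def)
  ultimately show ?thesis
    unfolding invariant_def using component_self
    by (auto simp: enc enc_bag_def loaded_def)
qed

lemma invariant_step:
  assumes m: "m \<subseteq> min_places N" and inv: "invariant m D" and "dstep D D'"
  shows "invariant m D'"
proof -
  obtain tr where en: "tr \<in> fset (dtrans D)" "set_le_bag (dpre tr) (dmark D)"
    and D': "D' = dfire D tr"
    using assms(3) by (auto simp: dstep_def denabled_def)
  obtain \<Theta> \<D> where cons: "consistent m (marked D) (barred D) \<Theta> \<D>"
    using inv by (auto simp: invariant_def)
  have load: "\<forall>tr \<in> fset (dtrans D). loaded (barred D) tr"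
    and reg: "\<And>q. dmark D (Reg q) = 0 \<or> dmark D (Reg q) = 1"
    and bar: "\<And>p. dmark D (Bar p) = 0 \<or> dmark D (Bar p) = \<infinity>"
    using inv by (auto simp: invariant_def)
  obtain B' M where B': "B' \<subseteq> barred D" and M: "component B' M" and "tr \<in> T_pos M \<union> T_neg M"
    using load en(1) by (auto simp: loaded_def)
  then consider "tr \<in> T_pos M" | "tr \<in> T_neg M" by blast
  then show ?thesis
  proof cases
    case 1
    with M obtain C \<theta> G Y where C: "cell B' C"
      and props: "\<theta> \<subseteq> C \<inter> T" "\<forall>t \<in> \<theta>. pre N t \<subseteq> entry C \<union> (\<Union>u\<in>\<theta>. post N u)"
        "G = entry C \<union> (\<Union>t\<in>\<theta>. post N t) - (\<Union>t\<in>\<theta>. pre N t)"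
        "\<forall>t \<in> C \<inter> T. \<not> pre N t \<subseteq> G" "Y \<subseteq> exits C - G"
      and tr: "tr = (Reg ` entry C, DNet {||} (enc_bag G Y))"
      by (rule T_pos_cases)
    have entry: "entry C \<subseteq> marked D"
      using en(2) by (auto simp: tr dpre_def set_le_bag_def marked_def)
    note step = consistent_pos[OF m cons C B' entry props]
    have dm: "dmark D' (Reg q) = (dmark D (Reg q) - (if q \<in> entry C then 1 else 0)) + (if q \<in> G then 1 else 0)"
      "dmark D' (Bar q) = dmark D (Bar q) + (if q \<in> Y then \<infinity> else 0)" for q
      by (auto simp: D' dfire_def tr dpre_def enc_bag_def)
    \<comment> \<open>Disjointness from \<open>consistent_pos\<close> excludes a count of 2.\<close>
    have reg': "dmark D' (Reg q) = (if q \<in> marked D - entry C \<union> G then 1 else 0)" for q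
      using reg[of q] step(1) entry by (auto simp: dm marked_def)
    have "marked D' = marked D - entry C \<union> G"
      by (auto simp: marked_def[of D'] reg')
    moreover have barred: "barred D' = barred D \<union> Y"
      by (auto simp: barred_def dm)
    ultimately have "consistent m (marked D') (barred D') (\<Theta> \<union> \<theta>) (insert C \<D>)"
      using step(2) by simp
    moreover have "dtrans D' = dtrans D" by (simp add: D' dfire_def tr)
    moreover have "dmark D' (Bar q) \<in> {0, \<infinity>}" for q using bar[of q] by (auto simp: dm)
    ultimately show ?thesis
      unfolding invariant_def using load loaded_mono barred reg' by auto
  next
    case 2
    with M obtain C p Y M' where C: "cell B' C" and p: "p \<in> entry C"
      and Y: "Y \<subseteq> exits C" "Y \<subseteq> up {p}" and M': "component (insert p B') M'"
      and tr: "tr = ({Bar p}, DNet (dtrans (encode M' {})) (enc_bag {} Y))"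
      by (rule T_neg_cases)
    have pB: "p \<in> barred D" "p \<in> C"
      using en(2) p by (auto simp: tr dpre_def set_le_bag_def barred_def entry_def)
    \<comment> \<open>The consumed place \<open>Bar p\<close> holds \<open>\<infinity>\<close>, so
      subtracting 1 leaves it unchanged.\<close>
    have dm: "dmark D' (Reg q) = dmark D (Reg q)"
      "dmark D' (Bar q) = dmark D (Bar q) + (if q \<in> Y then \<infinity> else 0)" for q
      using bar[of q] pB(1) by (auto simp: D' dfire_def tr dpre_def enc_bag_def barred_def)
    have "marked D' = marked D" and barred: "barred D' = barred D \<union> Y"
      by (auto simp: marked_def barred_def dm)
    then have "consistent m (marked D') (barred D') \<Theta> \<D>"
      using consistent_neg[OF cons C B' pB Y] by simp
    moreover have "loaded (barred D') u" if "u \<in> fset (dtrans D')" for u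
    proof -
      have "u \<in> fset (dtrans D) \<or> u \<in> T_pos M' \<union> T_neg M'"
        using that encode_eq(1)[OF component_finite[OF M']] by (auto simp: D' dfire_def tr)
      then show ?thesis
      proof
        assume "u \<in> fset (dtrans D)"
        then show ?thesis using load loaded_mono barred by blast
      next
        assume "u \<in> T_pos M' \<union> T_neg M'"
        moreover have "insert p B' \<subseteq> barred D'" using barred B' pB(1) by blast
        ultimately show ?thesis using M' unfolding loaded_def by blast
      qed
    qed
    moreover have "dmark D' (Bar q) \<in> {0, \<infinity>}" "dmark D' (Reg q) \<in> {0, 1}" for q
      using bar[of q] reg[of q] by (auto simp: dm)
    ultimately show ?thesis unfolding invariant_def by blast
  qed
qed

lemma invariant_steps:
  assumes "m \<subseteq> min_places N" "dstep\<^sup>*\<^sup>* (encode N m) D"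
  shows "invariant m D"
  using assms(2)
proof (induction rule: rtranclp_induct)
  case base
  show ?case using assms(1) by (rule invariant_encode)
next
  case (step D D')
  show ?case using assms(1) step.IH step.hyps(2) by (rule invariant_step)
qed

section \<open>Presets of enabled transitions\<close>

lemma enabled_cases:
  assumes "invariant m D" "denabled D tr"
  obtains (pos) B C where "B \<subseteq> barred D" "cell B C" "entry C \<subseteq> marked D" "dpre tr = Reg ` entry C"
  | (neg) p where "dpre tr = {Bar p}"
proof -
  obtain B M where B: "B \<subseteq> barred D" and M: "component B M" and tr: "tr \<in> T_pos M \<union> T_neg M"
    using assms by (auto simp: invariant_def denabled_def loaded_def)
  have en: "set_le_bag (dpre tr) (dmark D)" using assms(2) by (simp add: denabled_def)
  from tr consider "tr \<in> T_pos M" | "tr \<in> T_neg M" by blast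
  then show ?thesis
  proof cases
    case 1
    then obtain C where C: "cell B C" "dpre tr = Reg ` entry C"
      using T_pos_cases[OF M] by (metis dpre_def fst_conv)
    then have "entry C \<subseteq> marked D"
      using en by (auto simp: set_le_bag_def marked_def)
    then show ?thesis using pos B C by blast
  next
    case 2
    then obtain p where "dpre tr = {Bar p}" by (auto simp: T_neg_def dpre_def)
    then show ?thesis by (rule neg)
  qed
qed

lemma enabled_presets:
  assumes inv: "invariant m D" and t: "denabled D t" and t': "denabled D t'"
  shows "dpre t = dpre t' \<or> dpre t \<inter> dpre t' = {}"
  using inv t
proof (cases rule: enabled_cases)
  case (pos B C)
  note t_pos = this
  show ?thesis
    using inv t'
  proof (cases rule: enabled_cases)
    case (pos B' C')
    obtain \<Theta> \<D> where "consistent m (marked D) (barred D) \<Theta> \<D>"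
      using inv by (auto simp: invariant_def)
    then have "C = C' \<or> C \<inter> C' = {}"
      using enabled_cells_disjoint t_pos(1-3) pos(1-3) by blast
    then show ?thesis using t_pos(4) pos(4) by (auto simp: entry_def)
  next
    case (neg p)
    then show ?thesis using t_pos by auto
  qed
next
  case (neg p)
  note t_neg = this
  show ?thesis
    using inv t' by (cases rule: enabled_cases) (use t_neg in auto)
qed

end

theorem theorem3p12:
  fixes N :: "'a net" and m :: "'a set"
    and T1 :: "'a dplace dtransition fset" and b :: "'a dplace \<Rightarrow> enat"
    and t t' :: "'a dplace dtransition"
  assumes "finite_net N" and "occurrence_net N"
    and "m \<subseteq> min_places N"
    and "dstep\<^sup>*\<^sup>* (encode N m) (DNet T1 b)"
    and "denabled (DNet T1 b) t" and "denabled (DNet T1 b) t'"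
  shows "dpre t = dpre t' \<or> dpre t \<inter> dpre t' = {}"
proof -
  interpret finite_occurrence_net N by unfold_locales (fact assms)+
  show ?thesis using enabled_presets[OF invariant_steps] assms by blast
qed

end
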